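(* Let $(X,\|\cdot\|)$ be a normable hw space. Then: (a) The triple $(X,\|\cdot\|,\langle\cdot|\cdot\rangle_{\spadesuit|conv})$ fulfils the CSB inequality, i.e. $|\langle\vec{x}|\vec{y}\rangle_{\spadesuit|conv}|\le\|\vec{x}\|\cdot\|\vec{y}\|$ for all $\vec{x},\vec{y}\in X$; hence the generalized Thy angle $\angle_{\overline{Thy}}(\vec{x},\vec{y})$ is defined for all $\vec{x}\ne\vec{0}\ne\vec{y}$. (b) The triple $(X,\|\cdot\|,\angle_{\overline{Thy}})$ fulfils (An 1), (An 2), (An 3), (An 4), (An 5), (An 6), (An 7); hence it is an angle space. (c) If $(X,\|\cdot\|)$ is a normed vector space, then $\angle_{\overline{Thy}}(\vec{x},\vec{y})=\angle_{Thy}(\vec{x},\vec{y})$ for all $\vec{x},\vec{y}\ne\vec{0}$. (d) If $(X,\langle\cdot|\cdot\rangle_{IP})$ is an inner product space (with $\|\vec{x}\|=\sqrt{\langle\vec{x}|\vec{x}\rangle_{IP}}$), then $\angle_{\overline{Thy}}(\vec{x},\vec{y})=\angle_{Euclid}(\vec{x},\vec{y})$ for all $\vec{x},\vec{y}\ne\vec{0}$. (e) In general, for a normable hw space the triple $(X,\|\cdot\|,\angle_{\overline{Thy}})$ does not fulfil (An 8), (An 9), (An 10): for each of these three conditions there is a normable hw space for which it fails. (f) The triple $(X,\|\cdot\|,\angle_{\overline{Thy}})$ satisfies (An 11).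
   Context: A homogeneously weighted vector space (hw space) is a real topological vector space $X$ with a continuous map $\|\cdot\|:X\to[0,\infty)$ satisfying $\|r\vec{x}\|=|r|\,\|\vec{x}\|$ for all $r\in\mathbb{R}$, $\vec{x}\in X$. Its unit ball is $\mathbf{B}=\{\vec{x}\in X:\|\vec{x}\|\le1\}$, its zero-set is $\mathsf{Z}=\{\vec{x}\in X:\|\vec{x}\|=0\}$, $conv(\mathbf{B})$ is the convex hull of $\mathbf{B}$, and $$\|\vec{x}\|_{|conv(\mathbf{B})}:=\inf\{r>0:\tfrac1r\vec{x}\in conv(\mathbf{B})\}$$ is its Minkowski functional, which is a seminorm on $X$. The hw space is called normable if $\|\cdot\|_{|conv(\mathbf{B})}$ is a norm on $X$; in this case $\mathsf{Z}=\{\vec{0}\}$. On a normable hw space define $\langle\vec{x}|\vec{y}\rangle_{\spadesuit|conv}:=0$ if $\vec{x}=\vec{0}$ or $\vec{y}=\vec{0}$, and otherwise $$\langle\vec{x}|\vec{y}\rangle_{\spadesuit|conv}:=\frac14\,\|\vec{x}\|\,\|\vec{y}\|\left[\left\|\frac{\vec{x}}{\|\vec{x}\|_{|conv(\mathbf{B})}}+\frac{\vec{y}}{\|\vec{y}\|_{|conv(\mathbf{B})}}\right\|_{|conv(\mathbf{B})}^2-\left\|\frac{\vec{x}}{\|\vec{x}\|_{|conv(\mathbf{B})}}-\frac{\vec{y}}{\|\vec{y}\|_{|conv(\mathbf{B})}}\right\|_{|conv(\mathbf{B})}^2\right].$$ For $\vec{x},\vec{y}\ne\vec{0}$ with $|\langle\vec{x}|\vec{y}\rangle_{\spadesuit|conv}|\le\|\vec{x}\|\,\|\vec{y}\|$,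 the generalized Thy angle is $\angle_{\overline{Thy}}(\vec{x},\vec{y}):=\arccos\frac{\langle\vec{x}|\vec{y}\rangle_{\spadesuit|conv}}{\|\vec{x}\|\,\|\vec{y}\|}$. In a normed space, for $\vec{x},\vec{y}\ne\vec{0}$, the Thy angle is $\angle_{Thy}(\vec{x},\vec{y}):=\arccos\left(\frac14\left[\left\|\frac{\vec{x}}{\|\vec{x}\|}+\frac{\vec{y}}{\|\vec{y}\|}\right\|^2-\left\|\frac{\vec{x}}{\|\vec{x}\|}-\frac{\vec{y}}{\|\vec{y}\|}\right\|^2\right]\right)$. In an inner product space, $\angle_{Euclid}(\vec{x},\vec{y}):=\arccos\frac{\langle\vec{x}|\vec{y}\rangle_{IP}}{\|\vec{x}\|\,\|\vec{y}\|}$. For a hw space $(X,\|\cdot\|)$ and an angle $\angle_X$ consider the conditions: (An 1) $\angle_X$ is a continuous function from $[X\setminus\mathsf{Z}]^2$ into $[0,\pi]$. (An 2) $\angle_X(\vec{x},\vec{x})=0$ for all $\vec{x}\in X\setminus\mathsf{Z}$. (An 3) $\angle_X(-\vec{x},\vec{x})=\pi$ for all $\vec{x}\in X\setminus\mathsf{Z}$. (An 4) $\angle_X(\vec{x},\vec{y})=\angle_X(\vec{y},\vec{x})$ for all $\vec{x},\vec{y}\in X\setminus\mathsf{Z}$. (An 5) $\angle_X(r\vec{x},s\vec{y})=\angle_X(\vec{x},\vec{y})$ for all $\vec{x},\vec{y}\in X\setminus\mathsf{Z}$ and $r,s>0$. (An 6) $\angle_X(-\vec{x},-\vec{y})=\angle_X(\vec{x},\vec{y})$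 for all $\vec{x},\vec{y}\in X\setminus\mathsf{Z}$. (An 7) $\angle_X(\vec{x},\vec{y})+\angle_X(-\vec{x},\vec{y})=\pi$ for all $\vec{x},\vec{y}\in X\setminus\mathsf{Z}$. (An 8) $\angle_X(\vec{x},\vec{x}+\vec{y})+\angle_X(\vec{x}+\vec{y},\vec{y})=\angle_X(\vec{x},\vec{y})$ for all $\vec{x},\vec{y},\vec{x}+\vec{y}\in X\setminus\mathsf{Z}$. (An 9) $\angle_X(\vec{x},\vec{y})+\angle_X(-\vec{x},\vec{y}-\vec{x})+\angle_X(-\vec{y},\vec{x}-\vec{y})=\pi$ for all $\vec{x},\vec{y},\vec{x}-\vec{y}\in X\setminus\mathsf{Z}$. (An 10) $\angle_X(\vec{y},\vec{y}-\vec{x})+\angle_X(\vec{x},\vec{x}-\vec{y})=\angle_X(-\vec{x},\vec{y})$ for all $\vec{x},\vec{y},\vec{x}-\vec{y}\in X\setminus\mathsf{Z}$. (An 11) For any two linearly independent vectors $\vec{x},\vec{y}\in X\setminus\mathsf{Z}$ the map $\mathbb{R}\to(0,\pi)$, $t\mapsto\angle_X(\vec{x},\vec{y}+t\vec{x})$ is a decreasing homeomorphism. The triple $(X,\|\cdot\|,\angle_X)$ is called an angle space if (An 1)–(An 5) hold. *)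

theory Defs
  imports "HOL-Analysis.Analysis"
begin

(* The space X is the whole type 'a. Its topology is the one of the type class, and only the
   group operations are continuous by the class; joint continuity of scalar multiplication is
   required in real_tvs. *)

definition real_tvs :: "'a::{real_vector, topological_ab_group_add} itself \<Rightarrow> bool" where
  "real_tvs _ \<longleftrightarrow> continuous_on UNIV (\<lambda>(r::real, x::'a). r *\<^sub>R x)"

definition hw_space :: "('a::{real_vector, topological_ab_group_add} \<Rightarrow> real) \<Rightarrow> bool" where
  "hw_space w \<longleftrightarrow>
     real_tvs TYPE('a) \<and>
     continuous_on UNIV w \<and>
     (\<forall>x. 0 \<le> w x) \<and>
     (\<forall>r x. w (r *\<^sub>R x) = \<bar>r\<bar> * w x)"

definition hw_ball :: "('a::real_vector \<Rightarrow> real) \<Rightarrow> 'a set" where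
  "hw_ball w = {x. w x \<le> 1}"

definition zero_set :: "('a::real_vector \<Rightarrow> real) \<Rightarrow> 'a set" where
  "zero_set w = {x. w x = 0}"

definition conv_gauge :: "('a::real_vector \<Rightarrow> real) \<Rightarrow> 'a \<Rightarrow> real" where
  "conv_gauge w x = Inf {r. r > 0 \<and> (1 / r) *\<^sub>R x \<in> convex hull (hw_ball w)}"

definition is_norm :: "('a::real_vector \<Rightarrow> real) \<Rightarrow> bool" where
  "is_norm p \<longleftrightarrow>
     (\<forall>x. 0 \<le> p x) \<and>
     (\<forall>x. p x = 0 \<longleftrightarrow> x = 0) \<and>
     (\<forall>r x. p (r *\<^sub>R x) = \<bar>r\<bar> * p x) \<and>
     (\<forall>x y. p (x + y) \<le> p x + p y)"

definition is_inner_product :: "('a::real_vector \<Rightarrow> 'a \<Rightarrow> real) \<Rightarrow> bool" where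
  "is_inner_product ip \<longleftrightarrow>
     bilinear ip \<and>
     (\<forall>x y. ip x y = ip y x) \<and>
     (\<forall>x. x \<noteq> 0 \<longrightarrow> ip x x > 0)"

definition normable_hw_space :: "('a::{real_vector, topological_ab_group_add} \<Rightarrow> real) \<Rightarrow> bool" where
  "normable_hw_space w \<longleftrightarrow> hw_space w \<and> is_norm (conv_gauge w)"

definition spade_conv :: "('a::real_vector \<Rightarrow> real) \<Rightarrow> 'a \<Rightarrow> 'a \<Rightarrow> real" where
  "spade_conv w x y =
     (if x = 0 \<or> y = 0 then 0
      else 1 / 4 * w x * w y *
        ((conv_gauge w (x /\<^sub>R conv_gauge w x + y /\<^sub>R conv_gauge w y))\<^sup>2
         - (conv_gauge w (x /\<^sub>R conv_gauge w x - y /\<^sub>R conv_gauge w y))\<^sup>2))"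

(* Domain of the partial function gen_thy_angle; outside of it the value is arbitrary. *)
definition gen_thy_angle_defined :: "('a::real_vector \<Rightarrow> real) \<Rightarrow> 'a \<Rightarrow> 'a \<Rightarrow> bool" where
  "gen_thy_angle_defined w x y \<longleftrightarrow>
     x \<noteq> 0 \<and> y \<noteq> 0 \<and> w x * w y \<noteq> 0 \<and> \<bar>spade_conv w x y\<bar> \<le> w x * w y"

definition gen_thy_angle :: "('a::real_vector \<Rightarrow> real) \<Rightarrow> 'a \<Rightarrow> 'a \<Rightarrow> real" where
  "gen_thy_angle w x y = arccos (spade_conv w x y / (w x * w y))"

definition thy_angle :: "('a::real_vector \<Rightarrow> real) \<Rightarrow> 'a \<Rightarrow> 'a \<Rightarrow> real" where
  "thy_angle p x y =
     arccos (1 / 4 * ((p (x /\<^sub>R p x + y /\<^sub>R p y))\<^sup>2 - (p (x /\<^sub>R p x - y /\<^sub>R p y))\<^sup>2))"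

definition euclid_angle :: "('a::real_vector \<Rightarrow> 'a \<Rightarrow> real) \<Rightarrow> 'a \<Rightarrow> 'a \<Rightarrow> real" where
  "euclid_angle ip x y = arccos (ip x y / (sqrt (ip x x) * sqrt (ip y y)))"

definition An1 :: "('a::{real_vector, topological_ab_group_add} \<Rightarrow> real) \<Rightarrow> ('a \<Rightarrow> 'a \<Rightarrow> real) \<Rightarrow> bool" where
  "An1 w ang \<longleftrightarrow>
     continuous_on ((- zero_set w) \<times> (- zero_set w)) (\<lambda>(x, y). ang x y) \<and>
     (\<forall>x y. x \<notin> zero_set w \<and> y \<notin> zero_set w \<longrightarrow> ang x y \<in> {0..pi})"

definition An2 :: "('a::real_vector \<Rightarrow> real) \<Rightarrow> ('a \<Rightarrow> 'a \<Rightarrow> real) \<Rightarrow> bool" where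
  "An2 w ang \<longleftrightarrow> (\<forall>x. x \<notin> zero_set w \<longrightarrow> ang x x = 0)"

definition An3 :: "('a::real_vector \<Rightarrow> real) \<Rightarrow> ('a \<Rightarrow> 'a \<Rightarrow> real) \<Rightarrow> bool" where
  "An3 w ang \<longleftrightarrow> (\<forall>x. x \<notin> zero_set w \<longrightarrow> ang (- x) x = pi)"

definition An4 :: "('a::real_vector \<Rightarrow> real) \<Rightarrow> ('a \<Rightarrow> 'a \<Rightarrow> real) \<Rightarrow> bool" where
  "An4 w ang \<longleftrightarrow> (\<forall>x y. x \<notin> zero_set w \<and> y \<notin> zero_set w \<longrightarrow> ang x y = ang y x)"

definition An5 :: "('a::real_vector \<Rightarrow> real) \<Rightarrow> ('a \<Rightarrow> 'a \<Rightarrow> real) \<Rightarrow> bool" where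
  "An5 w ang \<longleftrightarrow>
     (\<forall>x y r s. x \<notin> zero_set w \<and> y \<notin> zero_set w \<and> r > 0 \<and> s > 0 \<longrightarrow>
        ang (r *\<^sub>R x) (s *\<^sub>R y) = ang x y)"

definition An6 :: "('a::real_vector \<Rightarrow> real) \<Rightarrow> ('a \<Rightarrow> 'a \<Rightarrow> real) \<Rightarrow> bool" where
  "An6 w ang \<longleftrightarrow>
     (\<forall>x y. x \<notin> zero_set w \<and> y \<notin> zero_set w \<longrightarrow> ang (- x) (- y) = ang x y)"

definition An7 :: "('a::real_vector \<Rightarrow> real) \<Rightarrow> ('a \<Rightarrow> 'a \<Rightarrow> real) \<Rightarrow> bool" where
  "An7 w ang \<longleftrightarrow>
     (\<forall>x y. x \<notin> zero_set w \<and> y \<notin> zero_set w \<longrightarrow> ang x y + ang (- x) y = pi)"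

definition An8 :: "('a::real_vector \<Rightarrow> real) \<Rightarrow> ('a \<Rightarrow> 'a \<Rightarrow> real) \<Rightarrow> bool" where
  "An8 w ang \<longleftrightarrow>
     (\<forall>x y. x \<notin> zero_set w \<and> y \<notin> zero_set w \<and> x + y \<notin> zero_set w \<longrightarrow>
        ang x (x + y) + ang (x + y) y = ang x y)"

definition An9 :: "('a::real_vector \<Rightarrow> real) \<Rightarrow> ('a \<Rightarrow> 'a \<Rightarrow> real) \<Rightarrow> bool" where
  "An9 w ang \<longleftrightarrow>
     (\<forall>x y. x \<notin> zero_set w \<and> y \<notin> zero_set w \<and> x - y \<notin> zero_set w \<longrightarrow>
        ang x y + ang (- x) (y - x) + ang (- y) (x - y) = pi)"

definition An10 :: "('a::real_vector \<Rightarrow> real) \<Rightarrow> ('a \<Rightarrow> 'a \<Rightarrow> real) \<Rightarrow> bool" where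
  "An10 w ang \<longleftrightarrow>
     (\<forall>x y. x \<notin> zero_set w \<and> y \<notin> zero_set w \<and> x - y \<notin> zero_set w \<longrightarrow>
        ang y (y - x) + ang x (x - y) = ang (- x) y)"

(* The inequation of x and y is needed because independence is a property of the set {x, y},
   which is a singleton for equal vectors. *)
definition An11 :: "('a::real_vector \<Rightarrow> real) \<Rightarrow> ('a \<Rightarrow> 'a \<Rightarrow> real) \<Rightarrow> bool" where
  "An11 w ang \<longleftrightarrow>
     (\<forall>x y. x \<notin> zero_set w \<and> y \<notin> zero_set w \<and> x \<noteq> y \<and> independent {x, y} \<longrightarrow>
        strict_antimono_on (UNIV::real set) (\<lambda>t. ang x (y + t *\<^sub>R x)) \<and>
        (\<exists>g. homeomorphism UNIV {0<..<pi} (\<lambda>t. ang x (y + t *\<^sub>R x)) g))"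

definition angle_space ::
  "('a::{real_vector, topological_ab_group_add} \<Rightarrow> real) \<Rightarrow> ('a \<Rightarrow> 'a \<Rightarrow> real) \<Rightarrow> bool" where
  "angle_space w ang \<longleftrightarrow>
     hw_space w \<and> An1 w ang \<and> An2 w ang \<and> An3 w ang \<and> An4 w ang \<and> An5 w ang"

end

theory Submission
  imports Defs
begin

text \<open>
  On nonzero vectors the two factors \<open>w x\<close> and \<open>w y\<close> of the product cancel in the quotient
  under the arccosine. The generalized Thy angle of \<open>w\<close> is therefore the ordinary Thy angle of
  the norm \<open>p = conv_gauge w\<close>. The estimate \<open>p \<le> w\<close> makes \<open>p\<close> continuous for the given
  topology and makes \<open>w\<close> vanish at the origin only. The
  CSB inequality is the triangle inequality for two \<open>p\<close>-unit vectors, whose sum and difference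
  have norm at most 2, and (An 1)--(An 7) come from the symmetries and the continuity of the
  cosine \<open>thy_cos p\<close>. A weight that is a norm equals its gauge, because its ball is convex;
  this gives the comparison with normed spaces, and the polarization identity then gives the
  comparison with inner product spaces. The sum norm of the plane violates (An 8)--(An 10),
  already at its two standard unit vectors.

  The substantial part is (An 11). For a \<open>p\<close>-unit vector \<open>u\<close> put \<open>N t = p (y + t u)\<close> and let
  \<open>v t\<close> be the normalized vector \<open>y + t u\<close>. Then \<open>p (u + v t) = N (t + N t) / N t\<close> and
  \<open>p (u - v t) = N (t - N t) / N t\<close>, so the cosine along the line is an expression in one convex
  real function whose slopes are at most 1 in absolute value. These two properties imply that
  the first ratio is nondecreasing and the second nonincreasing (\<open>convex_shift_ratio\<close>),
  which is the monotonicity lemma of Minkowski geometry. Each of them can be constant on an interval, since unit spheres may contain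
  segments. They cannot both be constant on the same interval, because the
  triangle inequality also gives \<open>\<bar>s - t\<bar> \<le> N s + N t\<close> (\<open>convex_shift_ratio_strict\<close>).
  So the cosine is strictly increasing. It tends to 1 as \<open>v t\<close> tends to \<open>u\<close> (\<open>thy_cos_unit_line_near_1\<close>), and by
  reflection to -1 at the other end, so the angle maps the line homeomorphically onto the
  open interval from 0 to \<open>\<pi>\<close>.
\<close>

section \<open>Norms and the Thy cosine\<close>

definition thy_cos :: "('a::real_vector \<Rightarrow> real) \<Rightarrow> 'a \<Rightarrow> 'a \<Rightarrow> real" where
  "thy_cos p x y =
     1 / 4 * ((p (x /\<^sub>R p x + y /\<^sub>R p y))\<^sup>2 - (p (x /\<^sub>R p x - y /\<^sub>R p y))\<^sup>2)"

lemma thy_angle_eq_arccos: "thy_angle p x y = arccos (thy_cos p x y)"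
  by (simp add: thy_angle_def thy_cos_def)

lemma is_norm_minus: "p (- x) = p x" if "is_norm p"
proof -
  have "p (- 1 *\<^sub>R x) = \<bar>- 1\<bar> * p x"
    using that unfolding is_norm_def by blast
  then show ?thesis by simp
qed

lemma is_norm_minus_commute: "p (x - y) = p (y - x)" if "is_norm p"
  using is_norm_minus[OF that, of "x - y"] by simp

lemma is_norm_triangle: "p (x + y) \<le> p x + p y" if "is_norm p"
  using that unfolding is_norm_def by blast

lemma is_norm_triangle_diff: "p (x - y) \<le> p x + p y" if "is_norm p"
  using is_norm_triangle[OF that, of x "- y"] is_norm_minus[OF that] by simp

lemma is_norm_scaleR: "p (r *\<^sub>R x) = \<bar>r\<bar> * p x" if "is_norm p"
  using that unfolding is_norm_def by blast

lemma is_norm_pos: "0 < p x" if "is_norm p" "x \<noteq> 0"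
  using that unfolding is_norm_def by (metis order_le_less)

lemma is_norm_normalize: "p (x /\<^sub>R p x) = 1" if "is_norm p" "x \<noteq> 0"
  using is_norm_pos[OF that] is_norm_scaleR[OF that(1)] by simp

lemma is_norm_diff_le: "\<bar>p x - p y\<bar> \<le> p (x - y)" if "is_norm p"
  using is_norm_triangle[OF that, of "x - y" y] is_norm_triangle[OF that, of "y - x" x]
    is_norm_minus_commute[OF that, of x y] by simp

lemma thy_cos_abs_le_1:
  assumes p: "is_norm p" and "x \<noteq> 0" "y \<noteq> 0"
  shows "\<bar>thy_cos p x y\<bar> \<le> 1"
proof -
  have square: "0 \<le> (p z)\<^sup>2 \<and> (p z)\<^sup>2 \<le> 4" if "p z \<le> 2" for z
  proof -
    have "0 \<le> p z" using p unfolding is_norm_def by blast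
    then have "(p z)\<^sup>2 \<le> 2\<^sup>2" using that by (intro power_mono)
    then show ?thesis by simp
  qed
  have "p (x /\<^sub>R p x + y /\<^sub>R p y) \<le> 2" "p (x /\<^sub>R p x - y /\<^sub>R p y) \<le> 2"
    using is_norm_triangle[OF p, of "x /\<^sub>R p x" "y /\<^sub>R p y"]
      is_norm_triangle_diff[OF p, of "x /\<^sub>R p x" "y /\<^sub>R p y"]
      is_norm_normalize[OF p] assms by simp_all
  then have "0 \<le> (p (x /\<^sub>R p x + y /\<^sub>R p y))\<^sup>2" "(p (x /\<^sub>R p x + y /\<^sub>R p y))\<^sup>2 \<le> 4"
    "0 \<le> (p (x /\<^sub>R p x - y /\<^sub>R p y))\<^sup>2" "(p (x /\<^sub>R p x - y /\<^sub>R p y))\<^sup>2 \<le> 4"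
    using square by blast+
  moreover have "\<bar>1 / 4 * (a - b)\<bar> \<le> 1" if "0 \<le> a" "a \<le> 4" "0 \<le> b" "b \<le> 4" for a b :: real
    using that by (simp add: abs_le_iff)
  ultimately show ?thesis unfolding thy_cos_def by blast
qed

lemma thy_cos_self: "thy_cos p x x = 1" if "is_norm p" "x \<noteq> 0"
proof -
  define v where "v = x /\<^sub>R p x"
  have "p (v + v) = p (2 *\<^sub>R v)" by (simp only: scaleR_2)
  also have "\<dots> = 2"
    using is_norm_scaleR[OF that(1), of 2 v] is_norm_normalize[OF that] by (simp add: v_def)
  finally have "p (v + v) = 2" .
  moreover have "p 0 = 0" using that(1) unfolding is_norm_def by blast
  ultimately show ?thesis unfolding thy_cos_def v_def by simp
qed

lemma thy_cos_commute: "thy_cos p x y = thy_cos p y x" if "is_norm p"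
  unfolding thy_cos_def
  using is_norm_minus_commute[OF that, of "x /\<^sub>R p x"] by (simp add: add.commute)

lemma thy_cos_minus_right: "thy_cos p x (- y) = - thy_cos p x y" if "is_norm p"
proof -
  have unit: "(- y) /\<^sub>R p (- y) = - (y /\<^sub>R p y)" by (simp add: is_norm_minus[OF that])
  have "1 / 4 * (b - a) = - (1 / 4 * (a - b))" for a b :: real by algebra
  then show ?thesis
    unfolding thy_cos_def unit add_uminus_conv_diff diff_minus_eq_add .
qed

lemma thy_cos_minus_left: "thy_cos p (- x) y = - thy_cos p x y" if "is_norm p"
  using thy_cos_commute[OF that] thy_cos_minus_right[OF that] by metis

lemma thy_cos_scaleR:
  assumes p: "is_norm p" and "0 < r" "0 < s"
  shows "thy_cos p (r *\<^sub>R x) (s *\<^sub>R y) = thy_cos p x y"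
proof -
  have "(k *\<^sub>R z) /\<^sub>R p (k *\<^sub>R z) = z /\<^sub>R p z" if "0 < k" for k z
    using that by (simp add: is_norm_scaleR[OF p] mult.assoc[symmetric])
  from this[OF \<open>0 < r\<close>] this[OF \<open>0 < s\<close>] show ?thesis unfolding thy_cos_def by (simp only:)
qed

section \<open>Shifts of a convex function by its own value\<close>

text \<open>
  Let \<open>T = t + N t\<close>. Since \<open>N\<close> falls by at most \<open>t - s\<close> from \<open>s\<close> to \<open>t\<close>, both \<open>t\<close> and
  \<open>s + N s\<close> lie in the interval from \<open>s\<close> to \<open>T\<close>, whose length is \<open>D\<close>. The claims compare the
  values of \<open>N\<close> at these two points with the chord over that interval. Geometrically, the
  two chord estimates are triangle inequalities around the crossing point of the diagonals in
  the quadrilateral of \<open>0\<close>, \<open>- u\<close>, \<open>v s\<close>, \<open>v t\<close>. The second conclusion is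
  the chord estimate at \<open>s + N s\<close>. It turns into an upper bound for the ratio when the ratio is
  the same at \<open>s\<close> and \<open>t\<close>.
\<close>

lemma convex_shift_ratio:
  fixes N :: "real \<Rightarrow> real"
  assumes conv: "convex_on UNIV N" and pos: "\<And>t. 0 < N t"
    and lip: "N s - N t \<le> t - s" and st: "s < t"
  defines "D \<equiv> t - s + N t"
  shows "N (s + N s) / N s \<le> N (t + N t) / N t"
    and "D * (N (s + N s) / N s) \<le> D - N s + N t * (N (t + N t) / N t)"
proof -
  have D: "0 < D" using st pos[of t] by (simp add: D_def)
  then have D0: "D \<noteq> 0" by simp
  have gap: "t + N t - s = D" by (simp add: D_def)
  have comb: "N ((1 - l) * a + l * b) \<le> (1 - l) * N a + l * N b" if "0 \<le> l" "l \<le> 1" for l a b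
    using convex_onD[OF conv that, of a b] by simp
  have "(1 - (t - s) / D) * s + (t - s) / D * (t + N t) = s + (t - s) / D * (t + N t - s)"
    by (simp add: algebra_simps)
  also have "\<dots> = t" using D0 by (simp add: gap)
  finally have mid_t: "N t \<le> (1 - (t - s) / D) * N s + (t - s) / D * N (t + N t)"
    using comb[of "(t - s) / D" s "t + N t"] st pos[of t] D by (simp add: D_def)
  have "D * N t \<le> D * ((1 - (t - s) / D) * N s + (t - s) / D * N (t + N t))"
    using mid_t D by (simp add: mult_left_mono)
  also have "\<dots> = (D - (t - s)) * N s + (t - s) * N (t + N t)"
    using D0 by (simp add: field_simps)
  finally have *: "D * N t \<le> N t * N s + (t - s) * N (t + N t)" by (simp add: D_def)
  have one: "D - N s \<le> (t - s) * (N (t + N t) / N t)"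
    using * pos[of t] by (simp add: field_simps)
  have "(1 - N s / D) * s + N s / D * (t + N t) = s + N s / D * (t + N t - s)"
    by (simp add: algebra_simps)
  also have "\<dots> = s + N s" using D0 by (simp add: gap)
  finally have mid_s: "N (s + N s) \<le> (1 - N s / D) * N s + N s / D * N (t + N t)"
    using comb[of "N s / D" s "t + N t"] lip pos[of s] D by (simp add: D_def)
  have "D * N (s + N s) \<le> D * ((1 - N s / D) * N s + N s / D * N (t + N t))"
    using mid_s D by (simp add: mult_left_mono)
  also have "\<dots> = (D - N s + N (t + N t)) * N s"
    using D0 by (simp add: field_simps)
  finally have "D * (N (s + N s) / N s) \<le> D - N s + N (t + N t)"
    using pos[of s] by (simp add: field_simps)
  then show two: "D * (N (s + N s) / N s) \<le> D - N s + N t * (N (t + N t) / N t)"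
    using pos[of t] by simp
  have "D * (N (s + N s) / N s) \<le> (t - s) * (N (t + N t) / N t) + N t * (N (t + N t) / N t)"
    using one two by linarith
  also have "\<dots> = D * (N (t + N t) / N t)" by (simp only: D_def distrib_right)
  finally show "N (s + N s) / N s \<le> N (t + N t) / N t"
    by (simp only: mult_le_cancel_left_pos[OF D])
qed

text \<open>
  If both ratios were equal at \<open>s\<close> and \<open>t\<close>, the chord estimates would bound them by
  \<open>1 + n / d\<close> and \<open>1 - n / d\<close>, where \<open>n\<close> is the increment of \<open>N\<close> over the distance \<open>d = t - s\<close>;
  as the ratios are positive, \<open>\<bar>n\<bar> < d\<close>. The separation hypothesis at the outermost points
  \<open>s - N s\<close> and \<open>t + N t\<close> yields \<open>d\<^sup>2 \<le> n\<^sup>2\<close> in contradiction to this.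
\<close>

lemma convex_shift_ratio_strict:
  fixes N :: "real \<Rightarrow> real"
  assumes conv: "convex_on UNIV N" and pos: "\<And>t. 0 < N t"
    and lip: "\<And>s t. \<bar>N s - N t\<bar> \<le> \<bar>s - t\<bar>" and sep: "\<And>s t. \<bar>s - t\<bar> \<le> N s + N t"
    and st: "s < t"
  shows "(N (s + N s) / N s)\<^sup>2 - (N (s - N s) / N s)\<^sup>2
       < (N (t + N t) / N t)\<^sup>2 - (N (t - N t) / N t)\<^sup>2"
proof -
  define a where "a r = N (r + N r) / N r" for r
  define b where "b r = N (r - N r) / N r" for r
  \<comment> \<open>Reflection turns the ratio \<open>b\<close> into the ratio \<open>a\<close> of \<open>M\<close> and reverses the order of points.\<close>
  define M where "M r = N (- r)" for r
  have apos: "0 < a r" and bpos: "0 < b r" for r using pos by (simp_all add: a_def b_def)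
  have a_le: "a s \<le> a t"
    and a_slope: "(t - s + N t) * a s \<le> t - s + N t - N s + N t * a t"
    using convex_shift_ratio[OF conv pos _ st] lip[of s t] st by (simp_all add: a_def)
  have convM: "convex_on UNIV M"
  proof (rule convex_onI)
    fix l x y :: real assume "0 < l" "l < 1"
    then have "N ((1 - l) * (- x) + l * (- y)) \<le> (1 - l) * N (- x) + l * N (- y)"
      using convex_onD[OF conv, of l "- x" "- y"] by simp
    moreover have "(1 - l) * (- x) + l * (- y) = - ((1 - l) * x + l * y)" by simp
    ultimately show "M ((1 - l) *\<^sub>R x + l *\<^sub>R y) \<le> (1 - l) * M x + l * M y"
      unfolding M_def by (metis real_scaleR_def)
  qed simp
  have b_le: "b t \<le> b s"
    and b_slope: "(t - s + N s) * b t \<le> t - s + N s - N t + N s * b s"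
    using convex_shift_ratio[OF convM, of "- t" "- s"] pos lip[of t s] st
    by (simp_all add: a_def b_def M_def)
  have "\<not> (a s = a t \<and> b s = b t)"
  proof
    assume eq: "a s = a t \<and> b s = b t"
    define d n where "d = t - s" and "n = N t - N s"
    have d: "0 < d" using st by (simp add: d_def)
    have A: "d * a t \<le> d + n" using a_slope eq by (simp add: d_def n_def algebra_simps)
    have B: "d * b s \<le> d - n" using b_slope eq by (simp add: d_def n_def algebra_simps)
    have "\<bar>(t + N t) - (s - N s)\<bar> \<le> N (t + N t) + N (s - N s)" by (rule sep)
    then have "d + N s + N t \<le> N s * b s + N t * a t"
      using st pos[of s] pos[of t] by (simp add: a_def b_def d_def)
    then have "d * (d + N s + N t) \<le> d * (N s * b s + N t * a t)"
      using d by (simp add: mult_left_mono)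
    also have "\<dots> = N s * (d * b s) + N t * (d * a t)" by (simp add: algebra_simps)
    also have "\<dots> \<le> N s * (d - n) + N t * (d + n)"
      using A B pos[of s] pos[of t] by (intro add_mono mult_left_mono) auto
    also have "\<dots> = d * (N s + N t) + n\<^sup>2" by (simp add: n_def power2_eq_square algebra_simps)
    finally have "d\<^sup>2 \<le> n\<^sup>2" by (simp add: power2_eq_square algebra_simps)
    moreover have "\<bar>n\<bar> < \<bar>d\<bar>"
    proof -
      have "0 < d * a t" "0 < d * b s" using d apos bpos by simp_all
      then show ?thesis using A B by linarith
    qed
    ultimately show False by (simp add: abs_le_square_iff[symmetric])
  qed
  then have "a s < a t \<or> b t < b s" using a_le b_le by linarith
  moreover have "(a s)\<^sup>2 \<le> (a t)\<^sup>2" "(b t)\<^sup>2 \<le> (b s)\<^sup>2"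
    using a_le b_le apos bpos by (simp_all add: power_mono less_imp_le)
  moreover have "a s < a t \<Longrightarrow> (a s)\<^sup>2 < (a t)\<^sup>2" "b t < b s \<Longrightarrow> (b t)\<^sup>2 < (b s)\<^sup>2"
    using apos bpos by (simp_all add: power_strict_mono less_imp_le)
  ultimately have "(a s)\<^sup>2 - (b s)\<^sup>2 < (a t)\<^sup>2 - (b t)\<^sup>2" by argo
  then show ?thesis by (simp add: a_def b_def)
qed

section \<open>The Thy cosine along a line\<close>

text \<open>
  Adding \<open>u\<close> to the unit vector in direction \<open>y + t u\<close> gives, up to the factor \<open>N t\<close>, another
  point of the same line, at parameter \<open>t + N t\<close>; subtracting \<open>u\<close> leads to \<open>t - N t\<close>.
\<close>

lemma thy_cos_on_line:
  assumes p: "is_norm p" and u: "p u = 1" and nz: "y + t *\<^sub>R u \<noteq> 0"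
  defines "N \<equiv> \<lambda>t. p (y + t *\<^sub>R u)"
  shows "thy_cos p u (y + t *\<^sub>R u) = ((N (t + N t) / N t)\<^sup>2 - (N (t - N t) / N t)\<^sup>2) / 4"
proof -
  have N: "0 < N t" using is_norm_pos[OF p nz] by (simp add: N_def)
  have "u + (y + t *\<^sub>R u) /\<^sub>R N t = (y + (t + N t) *\<^sub>R u) /\<^sub>R N t"
    using N by (simp add: algebra_simps)
  moreover have "(y + t *\<^sub>R u) /\<^sub>R N t - u = (y + (t - N t) *\<^sub>R u) /\<^sub>R N t"
    using N by (simp add: algebra_simps)
  ultimately have "p (u + (y + t *\<^sub>R u) /\<^sub>R N t) = N (t + N t) / N t"
    "p (u - (y + t *\<^sub>R u) /\<^sub>R N t) = N (t - N t) / N t"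
    using N is_norm_scaleR[OF p] is_norm_minus_commute[OF p, of u]
    by (simp_all add: N_def divide_inverse_commute)
  moreover have "p (y + t *\<^sub>R u) = N t" by (simp add: N_def)
  ultimately show ?thesis using u by (simp add: thy_cos_def)
qed

lemma thy_cos_unit_line_strict_mono:
  assumes p: "is_norm p" and u: "p u = 1" and nz: "\<And>t. y + t *\<^sub>R u \<noteq> 0"
  shows "strict_mono (\<lambda>t. thy_cos p u (y + t *\<^sub>R u))"
proof (rule strict_monoI)
  fix s t :: real assume st: "s < t"
  define N where "N r = p (y + r *\<^sub>R u)" for r
  have diff: "(y + r *\<^sub>R u) - (y + q *\<^sub>R u) = (r - q) *\<^sub>R u" for r q
    by (simp add: algebra_simps)
  have conv: "convex_on UNIV N"
  proof (rule convex_onI)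
    fix l r q :: real assume l: "0 < l" "l < 1"
    have "y + ((1 - l) *\<^sub>R r + l *\<^sub>R q) *\<^sub>R u
        = (1 - l) *\<^sub>R (y + r *\<^sub>R u) + l *\<^sub>R (y + q *\<^sub>R u)"
      by (simp add: algebra_simps)
    then show "N ((1 - l) *\<^sub>R r + l *\<^sub>R q) \<le> (1 - l) * N r + l * N q"
      using is_norm_triangle[OF p, of "(1 - l) *\<^sub>R (y + r *\<^sub>R u)" "l *\<^sub>R (y + q *\<^sub>R u)"]
        is_norm_scaleR[OF p] l by (simp add: N_def)
  qed simp
  have pos: "0 < N r" for r using is_norm_pos[OF p nz] by (simp add: N_def)
  have lip: "\<bar>N r - N q\<bar> \<le> \<bar>r - q\<bar>" for r q
    using is_norm_diff_le[OF p, of "y + r *\<^sub>R u" "y + q *\<^sub>R u"]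
    unfolding diff is_norm_scaleR[OF p] u N_def by simp
  have sep: "\<bar>r - q\<bar> \<le> N r + N q" for r q
    using is_norm_triangle_diff[OF p, of "y + r *\<^sub>R u" "y + q *\<^sub>R u"]
    unfolding diff is_norm_scaleR[OF p] u N_def by simp
  show "thy_cos p u (y + s *\<^sub>R u) < thy_cos p u (y + t *\<^sub>R u)"
    unfolding thy_cos_on_line[OF p u nz]
    using convex_shift_ratio_strict[OF conv pos lip sep st] by (simp add: N_def)
qed

text \<open>
  For large \<open>t\<close> the numbers \<open>n = p (y + t u)\<close> and \<open>t\<close> differ by at most \<open>p y\<close>, so the unit vector
  \<open>v\<close> in direction \<open>y + t u\<close> has distance at most \<open>2 p y / n\<close> from \<open>u\<close>. A small \<open>p (u - v)\<close>
  forces \<open>p (u + v)\<close> to be close to 2, because the two vectors add up to \<open>2 u\<close>.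
\<close>

lemma thy_cos_unit_line_near_1:
  assumes p: "is_norm p" and u: "p u = 1" and nz: "\<And>t. y + t *\<^sub>R u \<noteq> 0" and c: "c < 1"
  shows "\<exists>t. c < thy_cos p u (y + t *\<^sub>R u)"
proof -
  have "y \<noteq> 0" using nz[of 0] by simp
  then have y: "0 < p y" using p is_norm_pos by blast
  define e where "e = min 1 (1 - c)"
  have e: "0 < e" "e \<le> 1" "e \<le> 1 - c" using c by (simp_all add: e_def)
  \<comment> \<open>This parameter makes \<open>n \<ge> t - p y = 2 p y / e\<close>, and hence \<open>p (v - u) \<le> e\<close>.\<close>
  define t where "t = p y + 2 * p y / e"
  define v where "v = (y + t *\<^sub>R u) /\<^sub>R p (y + t *\<^sub>R u)"
  define n where "n = p (y + t *\<^sub>R u)"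
  have t: "0 < t" using y e by (simp add: t_def add_pos_pos)
  have n: "\<bar>n - t\<bar> \<le> p y"
    using is_norm_diff_le[OF p, of "y + t *\<^sub>R u" "t *\<^sub>R u"] is_norm_scaleR[OF p] u t
    by (simp add: n_def)
  then have n_ge: "2 * p y / e \<le> n" by (simp add: t_def)
  then have npos: "0 < n" using y e by (smt (verit) divide_pos_pos)
  have nu: "n *\<^sub>R (v - u) = y + (t - n) *\<^sub>R u"
    using npos by (simp add: v_def n_def[symmetric] algebra_simps)
  have "n * p (v - u) = p (y + (t - n) *\<^sub>R u)"
    using nu npos is_norm_scaleR[OF p, of n "v - u"] by simp
  also have "\<dots> \<le> 2 * p y"
    using is_norm_triangle[OF p, of y "(t - n) *\<^sub>R u"] is_norm_scaleR[OF p] u n by simp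
  also have "\<dots> \<le> n * e" using n_ge e by (simp add: field_simps)
  finally have "p (v - u) \<le> e" using npos by simp
  then have b: "p (u - v) \<le> e" using is_norm_minus_commute[OF p] by metis
  have "u + v = 2 *\<^sub>R u - (u - v)" by (simp add: scaleR_2)
  then have "2 \<le> p (u + v) + p (u - v)"
    using is_norm_triangle[OF p, of "u + v" "u - v"] is_norm_scaleR[OF p, of 2 u] u
    by (simp add: scaleR_2)
  then have a: "2 - e \<le> p (u + v)" using b by simp
  have "(p (u - v))\<^sup>2 \<le> e\<^sup>2"
    using b p e unfolding is_norm_def by (intro power_mono) auto
  moreover have "(2 - e)\<^sup>2 \<le> (p (u + v))\<^sup>2" using a e by (intro power_mono) auto
  ultimately have "(2 - e)\<^sup>2 - e\<^sup>2 \<le> 4 * thy_cos p u (y + t *\<^sub>R u)"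
    by (simp add: thy_cos_def u v_def)
  then have *: "1 - e \<le> thy_cos p u (y + t *\<^sub>R u)" by (simp add: power2_eq_square algebra_simps)
  \<comment> \<open>The estimate so far is not strict when \<open>e = 1 - c\<close>; a further step along the line makes it so.\<close>
  have "thy_cos p u (y + t *\<^sub>R u) < thy_cos p u (y + (t + 1) *\<^sub>R u)"
    using strict_monoD[OF thy_cos_unit_line_strict_mono[OF p u nz], of t "t + 1"] by simp
  then have "c < thy_cos p u (y + (t + 1) *\<^sub>R u)" using * e by linarith
  then show ?thesis by blast
qed

lemma thy_cos_line_reparam:
  assumes p: "is_norm p" and x: "x \<noteq> 0"
  shows "thy_cos p x (y + t *\<^sub>R x) = thy_cos p (x /\<^sub>R p x) (y + (t * p x) *\<^sub>R (x /\<^sub>R p x))"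
proof -
  have px: "0 < p x" using is_norm_pos[OF p x] .
  then have "(t * p x) *\<^sub>R (x /\<^sub>R p x) = t *\<^sub>R x" by simp
  then show ?thesis
    using thy_cos_scaleR[OF p, of "inverse (p x)" 1 x "y + t *\<^sub>R x"] px
    by (simp only: scaleR_one positive_imp_inverse_positive zero_less_one)
qed

lemma thy_cos_line_strict_mono:
  assumes p: "is_norm p" and x: "x \<noteq> 0" and nz: "\<And>t. y + t *\<^sub>R x \<noteq> 0"
  shows "strict_mono (\<lambda>t. thy_cos p x (y + t *\<^sub>R x))"
proof -
  have nz': "y + t *\<^sub>R (x /\<^sub>R p x) \<noteq> 0" for t using nz[of "t / p x"] by (simp add: divide_inverse)
  have px: "0 < p x" using is_norm_pos[OF p x] .
  show ?thesis
    unfolding thy_cos_line_reparam[OF p x] using px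
      thy_cos_unit_line_strict_mono[OF p is_norm_normalize[OF p x] nz']
    by (simp add: strict_mono_def)
qed

lemma thy_cos_line_near_1:
  assumes p: "is_norm p" and x: "x \<noteq> 0" and nz: "\<And>t. y + t *\<^sub>R x \<noteq> 0" and c: "c < 1"
  shows "\<exists>t. c < thy_cos p x (y + t *\<^sub>R x)"
proof -
  have nz': "y + t *\<^sub>R (x /\<^sub>R p x) \<noteq> 0" for t using nz[of "t / p x"] by (simp add: divide_inverse)
  have px: "0 < p x" using is_norm_pos[OF p x] .
  obtain t where "c < thy_cos p (x /\<^sub>R p x) (y + t *\<^sub>R (x /\<^sub>R p x))"
    using thy_cos_unit_line_near_1[OF p is_norm_normalize[OF p x] nz' c] by blast
  then have "c < thy_cos p x (y + (t / p x) *\<^sub>R x)"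
    using thy_cos_line_reparam[OF p x, of y "t / p x"] px by simp
  then show ?thesis by blast
qed

text \<open>
  Replacing \<open>y\<close> by \<open>- y\<close> reverses the direction of the line and the sign of the cosine, so the
  behaviour near -1 is the behaviour near 1 of the reflected line.
\<close>

lemma thy_cos_line_near_minus_1:
  assumes p: "is_norm p" and x: "x \<noteq> 0" and nz: "\<And>t. y + t *\<^sub>R x \<noteq> 0" and c: "- 1 < c"
  shows "\<exists>t. thy_cos p x (y + t *\<^sub>R x) < c"
proof -
  have "- y + t *\<^sub>R x = - (y + (- t) *\<^sub>R x)" for t by simp
  then have nz': "- y + t *\<^sub>R x \<noteq> 0" for t using nz[of "- t"] by (metis neg_equal_0_iff_equal)
  obtain t where "- c < thy_cos p x (- y + t *\<^sub>R x)"
    using thy_cos_line_near_1[OF p x nz', of "- c"] c by auto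
  also have "thy_cos p x (- y + t *\<^sub>R x) = - thy_cos p x (y + (- t) *\<^sub>R x)"
    using thy_cos_minus_right[OF p, of x "y + (- t) *\<^sub>R x"] by simp
  finally have "thy_cos p x (y + (- t) *\<^sub>R x) < c" by simp
  then show ?thesis by blast
qed

text \<open>
  Strict monotonicity gives injectivity and keeps the values away from 0 and \<open>\<pi>\<close>. Invariance of
  domain makes the inverse continuous. That every angle in between occurs follows from the
  intermediate value theorem for the cosine.
\<close>

lemma thy_angle_line_homeomorphism:
  assumes p: "is_norm p" and x: "x \<noteq> 0" and nz: "\<And>t. y + t *\<^sub>R x \<noteq> 0"
    and cont: "continuous_on UNIV (\<lambda>t. thy_cos p x (y + t *\<^sub>R x))"
  shows "strict_antimono_on UNIV (\<lambda>t. thy_angle p x (y + t *\<^sub>R x))"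
    and "\<exists>g. homeomorphism UNIV {0<..<pi} (\<lambda>t. thy_angle p x (y + t *\<^sub>R x)) g"
proof -
  define f where "f t = thy_cos p x (y + t *\<^sub>R x)" for t
  define h where "h t = thy_angle p x (y + t *\<^sub>R x)" for t
  have h: "h t = arccos (f t)" for t by (simp add: h_def f_def thy_angle_eq_arccos)
  have range: "- 1 \<le> f t" "f t \<le> 1" for t
    using thy_cos_abs_le_1[OF p x nz, of t] by (auto simp: f_def)
  have mono: "f s < f t" if "s < t" for s t
    using strict_monoD[OF thy_cos_line_strict_mono[OF p x nz] that] by (simp add: f_def)
  have anti: "h t < h s" if "s < t" for s t
    unfolding h using range mono[OF that] by (intro arccos_less_arccos) auto
  then show "strict_antimono_on UNIV (\<lambda>t. thy_angle p x (y + t *\<^sub>R x))"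
    by (auto simp: monotone_on_def h_def)
  have contf: "continuous_on UNIV f" using cont by (simp add: f_def)
  have conth: "continuous_on UNIV h"
    unfolding h using contf range by (intro continuous_on_arccos) auto
  have "inj h" using anti by (metis injI linorder_neqE_linordered_idom less_irrefl)
  then obtain g where g: "homeomorphism UNIV (h ` UNIV) h g"
    using invariance_of_domain_homeomorphism[OF open_UNIV conth] by auto
  have "h ` UNIV = {0<..<pi}"
  proof (rule set_eqI)
    fix \<theta>
    show "\<theta> \<in> h ` UNIV \<longleftrightarrow> \<theta> \<in> {0<..<pi}"
    proof
      assume "\<theta> \<in> h ` UNIV"
      then obtain t where t: "\<theta> = h t" by blast
      have "h (t + 1) < \<theta>" "\<theta> < h (t - 1)" using anti t by simp_all
      moreover have "0 \<le> h (t + 1)" "h (t - 1) \<le> pi"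
        unfolding h using range by (auto intro: arccos_lbound arccos_ubound)
      ultimately show "\<theta> \<in> {0<..<pi}" by simp
    next
      assume \<theta>: "\<theta> \<in> {0<..<pi}"
      have "cos \<theta> < 1" "- 1 < cos \<theta>"
        using \<theta> cos_monotone_0_pi[of 0 \<theta>] cos_monotone_0_pi[of \<theta> pi] by simp_all
      then obtain r s where rs: "f r < cos \<theta>" "cos \<theta> < f s"
        using thy_cos_line_near_1[OF p x nz] thy_cos_line_near_minus_1[OF p x nz]
        unfolding f_def by meson
      have "r \<le> s"
      proof (rule ccontr)
        assume "\<not> r \<le> s"
        then show False using mono[of s r] rs by simp
      qed
      then obtain t where "f t = cos \<theta>"
        using IVT'[of f r "cos \<theta>" s] rs continuous_on_subset[OF contf] by auto
      then have "h t = \<theta>" using \<theta> by (simp add: h arccos_cos)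
      then show "\<theta> \<in> h ` UNIV" by blast
    qed
  qed
  then show "\<exists>g. homeomorphism UNIV {0<..<pi} (\<lambda>t. thy_angle p x (y + t *\<^sub>R x)) g"
    using g unfolding h_def by metis
qed

section \<open>The gauge of the convex hull of the unit ball\<close>

text \<open>
  Every \<open>r > w x\<close> scales \<open>x\<close> into the ball itself, hence into its hull. Using \<open>w x + e\<close> in place
  of \<open>w x\<close> keeps the scaling factor positive when \<open>w x = 0\<close>.
\<close>

lemma conv_gauge_le:
  assumes "hw_space w"
  shows "conv_gauge w x \<le> w x"
proof (rule field_le_epsilon)
  fix e :: real assume "0 < e"
  define r where "r = w x + e"
  have w: "0 \<le> w x" "w ((1 / r) *\<^sub>R x) = \<bar>1 / r\<bar> * w x"
    using assms unfolding hw_space_def by blast+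
  have r: "0 < r" using w \<open>0 < e\<close> by (simp add: r_def)
  have "w ((1 / r) *\<^sub>R x) \<le> 1" using w r \<open>0 < e\<close> by (simp add: r_def)
  then have "(1 / r) *\<^sub>R x \<in> convex hull (hw_ball w)"
    by (intro hull_inc) (simp add: hw_ball_def)
  moreover have "bdd_below {r. 0 < r \<and> (1 / r) *\<^sub>R x \<in> convex hull (hw_ball w)}"
    by (rule bdd_belowI[of _ 0]) auto
  ultimately have "conv_gauge w x \<le> r"
    unfolding conv_gauge_def using r by (intro cInf_lower) auto
  then show "conv_gauge w x \<le> w x + e" by (simp add: r_def)
qed

lemma conv_gauge_norm_eq:
  assumes w: "is_norm w"
  shows "conv_gauge w = w"
proof
  fix x
  have "convex (hw_ball w)"
  proof (rule convexI)
    fix a b :: 'a and k l :: real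
    assume ab: "a \<in> hw_ball w" "b \<in> hw_ball w" and kl: "0 \<le> k" "0 \<le> l" "k + l = 1"
    have "w (k *\<^sub>R a + l *\<^sub>R b) \<le> k * w a + l * w b"
      using is_norm_triangle[OF w, of "k *\<^sub>R a" "l *\<^sub>R b"] is_norm_scaleR[OF w] kl by simp
    also have "\<dots> \<le> 1"
      using ab kl by (intro convex_bound_le) (auto simp: hw_ball_def)
    finally show "k *\<^sub>R a + l *\<^sub>R b \<in> hw_ball w" by (simp add: hw_ball_def)
  qed
  then have "{r. r > 0 \<and> (1 / r) *\<^sub>R x \<in> convex hull (hw_ball w)} = {r. r > 0 \<and> w x \<le> r}"
    by (auto simp: hull_same hw_ball_def is_norm_scaleR[OF w] field_simps)
  then have eq: "conv_gauge w x = Inf {r. r > 0 \<and> w x \<le> r}" by (simp add: conv_gauge_def)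
  have w0: "0 \<le> w x" using w unfolding is_norm_def by blast
  show "conv_gauge w x = w x"
    unfolding eq
  proof (rule cInf_eq_non_empty)
    show "{r. r > 0 \<and> w x \<le> r} \<noteq> {}" using w0 by (auto intro!: exI[of _ "w x + 1"])
    show "y \<le> w x" if "\<And>r. r \<in> {r. r > 0 \<and> w x \<le> r} \<Longrightarrow> y \<le> r" for y
    proof (rule field_le_epsilon)
      fix e :: real assume "0 < e"
      then show "y \<le> w x + e" using that[of "w x + e"] w0 by simp
    qed
  qed simp
qed

text \<open>
  The gauge is subadditive, so its oscillation around \<open>x\<close> is controlled by its values near the
  origin, and these lie below those of the continuous function \<open>w\<close>.
\<close>

lemma continuous_on_conv_gauge:
  assumes w: "normable_hw_space w"
  shows "continuous_on UNIV (conv_gauge w)"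
proof -
  have hw: "hw_space w" and p: "is_norm (conv_gauge w)"
    using w by (simp_all add: normable_hw_space_def)
  have "(conv_gauge w \<longlongrightarrow> conv_gauge w x) (at x)" for x
  proof (rule LIM_zero_cancel, rule Lim_null_comparison)
    show "\<forall>\<^sub>F y in at x. norm (conv_gauge w y - conv_gauge w x) \<le> w (y - x)"
      using is_norm_diff_le[OF p] conv_gauge_le[OF hw]
      by (intro always_eventually allI) (metis order_trans real_norm_def)
    have "continuous_on UNIV w" using hw by (simp add: hw_space_def)
    then have "continuous_on UNIV (\<lambda>y. w (y - x))"
      by (rule continuous_on_compose2)
        (intro continuous_on_diff continuous_on_id continuous_on_const subset_UNIV)+
    then have "\<forall>a. ((\<lambda>y. w (y - x)) \<longlongrightarrow> w (a - x)) (at a)"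
      by (simp add: continuous_on_def)
    then have "((\<lambda>y. w (y - x)) \<longlongrightarrow> w (x - x)) (at x)" ..
    moreover have "w (0 *\<^sub>R x) = \<bar>0\<bar> * w x" using hw unfolding hw_space_def by blast
    ultimately show "((\<lambda>y. w (y - x)) \<longlongrightarrow> 0) (at x)" by simp
  qed
  then show ?thesis by (simp add: continuous_on_def)
qed

section \<open>Continuity of the Thy cosine\<close>

lemma real_tvs_continuous_on_scaleR:
  fixes g :: "'b::topological_space \<Rightarrow> 'a::{real_vector, topological_ab_group_add}"
  assumes "real_tvs TYPE('a)" "continuous_on S f" "continuous_on S g"
  shows "continuous_on S (\<lambda>z. f z *\<^sub>R g z)"
  using continuous_on_compose2[of UNIV "\<lambda>(r::real, x::'a). r *\<^sub>R x" S "\<lambda>z. (f z, g z)"] assms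
  by (auto simp: real_tvs_def intro: continuous_on_Pair)

lemma continuous_on_thy_cos:
  fixes f g :: "'b::topological_space \<Rightarrow> 'a::{real_vector, topological_ab_group_add}"
  assumes tvs: "real_tvs TYPE('a)" and p: "is_norm p" "continuous_on UNIV p"
    and f: "continuous_on S f" "\<And>z. z \<in> S \<Longrightarrow> f z \<noteq> 0"
    and g: "continuous_on S g" "\<And>z. z \<in> S \<Longrightarrow> g z \<noteq> 0"
  shows "continuous_on S (\<lambda>z. thy_cos p (f z) (g z))"
proof -
  have pcont: "continuous_on S (\<lambda>z. p (k z))" if "continuous_on S k" for k
    using continuous_on_compose2[OF p(2) that] by simp
  have normalized: "continuous_on S (\<lambda>z. k z /\<^sub>R p (k z))"
    if k: "continuous_on S k" "\<And>z. z \<in> S \<Longrightarrow> k z \<noteq> 0" for k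
  proof (rule real_tvs_continuous_on_scaleR[OF tvs _ k(1)])
    have "p (k z) \<noteq> 0" if "z \<in> S" for z using is_norm_pos[OF p(1) k(2)[OF that]] by simp
    then show "continuous_on S (\<lambda>z. inverse (p (k z)))"
      using pcont[OF k(1)] by (intro continuous_on_inverse) auto
  qed
  show ?thesis
    unfolding thy_cos_def
    by (intro continuous_on_mult continuous_on_const continuous_on_diff continuous_on_power
        pcont continuous_on_add normalized f g)
qed

section \<open>Normable weights\<close>

lemma normable_weight_pos:
  assumes w: "normable_hw_space w" and x: "x \<noteq> 0"
  shows "0 < w x"
proof -
  have "0 < conv_gauge w x"
    using w x is_norm_pos unfolding normable_hw_space_def by blast
  then show ?thesis using conv_gauge_le[of w x] w by (auto simp: normable_hw_space_def)
qed

lemma normable_zero_set: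
  assumes w: "normable_hw_space w"
  shows "zero_set w = {0}"
proof -
  have "w (0 *\<^sub>R 0) = \<bar>0\<bar> * w 0"
    using w unfolding normable_hw_space_def hw_space_def by blast
  then have "w 0 = 0" by simp
  then show ?thesis using normable_weight_pos[OF w] unfolding zero_set_def
    by (metis (mono_tags, lifting) less_irrefl mem_Collect_eq singleton_iff set_eqI)
qed

lemma spade_conv_eq_thy_cos:
  assumes "x \<noteq> 0" "y \<noteq> 0"
  shows "spade_conv w x y = w x * w y * thy_cos (conv_gauge w) x y"
  using assms by (simp add: spade_conv_def thy_cos_def)

lemma spade_conv_CSB:
  assumes w: "normable_hw_space w"
  shows "\<bar>spade_conv w x y\<bar> \<le> w x * w y"
proof (cases "x = 0 \<or> y = 0")
  case True
  then show ?thesis using w by (simp add: spade_conv_def normable_hw_space_def hw_space_def)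
next
  case False
  then have nz: "x \<noteq> 0" "y \<noteq> 0" by auto
  have pos: "0 < w x * w y" using normable_weight_pos[OF w] nz by simp
  have "\<bar>spade_conv w x y\<bar> = w x * w y * \<bar>thy_cos (conv_gauge w) x y\<bar>"
    by (simp only: spade_conv_eq_thy_cos[OF nz] abs_mult[of "w x * w y"] abs_of_pos[OF pos])
  also have "\<dots> \<le> w x * w y * 1"
    using thy_cos_abs_le_1[OF _ nz] w pos
    by (intro mult_left_mono) (auto simp: normable_hw_space_def)
  finally show ?thesis by simp
qed

lemma gen_thy_angle_eq_thy_angle:
  assumes w: "normable_hw_space w" and nz: "x \<noteq> 0" "y \<noteq> 0"
  shows "gen_thy_angle w x y = thy_angle (conv_gauge w) x y"
  using normable_weight_pos[OF w] nz
  by (simp add: gen_thy_angle_def thy_angle_eq_arccos spade_conv_eq_thy_cos less_imp_neq[symmetric])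

section \<open>Inner product spaces\<close>

lemma is_inner_product_imp_norm:
  assumes ip: "is_inner_product ip" and w: "\<And>x. w x = sqrt (ip x x)"
  shows "is_norm w"
proof -
  have bil: "bilinear ip" and sym: "ip x y = ip y x" and pos: "x \<noteq> 0 \<Longrightarrow> 0 < ip x x" for x y
    using ip unfolding is_inner_product_def by blast+
  note rules = bilinear_ladd[OF bil] bilinear_radd[OF bil] bilinear_lmul[OF bil]
    bilinear_rmul[OF bil] bilinear_lzero[OF bil] bilinear_rzero[OF bil]
    bilinear_lsub[OF bil] bilinear_rsub[OF bil]
  have nonneg: "0 \<le> ip x x" for x
    using pos[of x] rules by (cases "x = 0") auto
  have cs: "(ip x y)\<^sup>2 \<le> ip x x * ip y y" for x y
  proof (cases "y = 0")
    case False
    \<comment> \<open>The vector is the component of \<open>x\<close> orthogonal to \<open>y\<close>, multiplied by \<open>ip y y\<close>.\<close>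
    have "0 \<le> ip (ip y y *\<^sub>R x - ip x y *\<^sub>R y) (ip y y *\<^sub>R x - ip x y *\<^sub>R y)" by (rule nonneg)
    also have "\<dots> = ip y y * (ip x x * ip y y - (ip x y)\<^sup>2)"
      using sym[of y x] by (simp add: rules power2_eq_square algebra_simps)
    finally show ?thesis using pos[OF False] by (simp add: zero_le_mult_iff)
  qed (simp add: rules)
  have tri: "w (x + y) \<le> w x + w y" for x y
  proof (rule power2_le_imp_le)
    have "ip x y \<le> sqrt (ip x x * ip y y)" using cs real_le_rsqrt by blast
    then have "ip x y \<le> w x * w y" by (simp add: w real_sqrt_mult)
    moreover have "(w z)\<^sup>2 = ip z z" for z using nonneg by (simp add: w)
    ultimately show "(w (x + y))\<^sup>2 \<le> (w x + w y)\<^sup>2"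
      using sym[of y x] by (simp add: power2_sum rules)
    show "0 \<le> w x + w y" using nonneg by (simp add: w)
  qed
  have hom: "w (r *\<^sub>R x) = \<bar>r\<bar> * w x" for r x
    by (simp add: w rules real_sqrt_mult mult.assoc[symmetric])
  have "w x = 0 \<longleftrightarrow> x = 0" for x using pos[of x] by (cases "x = 0") (auto simp: w rules)
  then show ?thesis using tri hom nonneg unfolding is_norm_def by (simp add: w)
qed

lemma thy_angle_eq_euclid_angle:
  assumes ip: "is_inner_product ip" and w: "\<And>x. w x = sqrt (ip x x)"
  shows "thy_angle w x y = euclid_angle ip x y"
proof -
  have bil: "bilinear ip" and sym: "ip x y = ip y x" for x y
    using ip unfolding is_inner_product_def by blast+
  note rules = bilinear_ladd[OF bil] bilinear_radd[OF bil] bilinear_lmul[OF bil]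
    bilinear_rmul[OF bil] bilinear_lsub[OF bil] bilinear_rsub[OF bil]
  have nonneg: "0 \<le> ip z z" for z
    using is_inner_product_imp_norm[OF ip w] w unfolding is_norm_def
    by (metis real_sqrt_ge_0_iff)
  have "(w z)\<^sup>2 = ip z z" for z using nonneg by (simp add: w)
  then have polar: "(w (a + b))\<^sup>2 - (w (a - b))\<^sup>2 = 4 * ip a b" for a b
    using sym[of b a] by (simp add: rules)
  have "ip (x /\<^sub>R w x) (y /\<^sub>R w y) = ip x y / (w x * w y)"
    by (simp only: bilinear_lmul[OF bil] bilinear_rmul[OF bil]) (simp add: divide_inverse)
  then have "1 / 4 * (4 * ip (x /\<^sub>R w x) (y /\<^sub>R w y)) = ip x y / (w x * w y)" by simp
  then show ?thesis unfolding thy_angle_def polar euclid_angle_def by (simp only: w)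
qed

section \<open>The sum norm on the plane\<close>

definition sum_norm :: "real \<times> real \<Rightarrow> real" where
  "sum_norm z = \<bar>fst z\<bar> + \<bar>snd z\<bar>"

lemma is_norm_sum_norm: "is_norm sum_norm"
  unfolding is_norm_def sum_norm_def
  by (auto simp: abs_mult distrib_left prod_eq_iff intro: order_trans[OF add_mono[OF abs_triangle_ineq abs_triangle_ineq]])

lemma normable_sum_norm: "normable_hw_space sum_norm"
proof -
  have "continuous_on UNIV (\<lambda>(r::real, x::real \<times> real). r *\<^sub>R x)"
    unfolding case_prod_beta by (intro continuous_intros)
  moreover have "continuous_on UNIV sum_norm"
    unfolding sum_norm_def by (intro continuous_intros)
  ultimately show ?thesis
    using is_norm_sum_norm conv_gauge_norm_eq[OF is_norm_sum_norm]
    unfolding normable_hw_space_def hw_space_def real_tvs_def is_norm_def by simp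
qed

text \<open>
  The product is 0 as soon as one vector is 0, so the formula for the angle then gives a right angle
  and the equation covers all arguments. In this form it can serve as a rewrite rule for
  concrete vectors.
\<close>

lemma gen_thy_angle_sum_norm:
  "gen_thy_angle sum_norm x y =
     (if x = 0 \<or> y = 0 then pi / 2 else arccos (thy_cos sum_norm x y))"
  using gen_thy_angle_eq_thy_angle[OF normable_sum_norm, of x y]
    conv_gauge_norm_eq[OF is_norm_sum_norm]
  by (auto simp: thy_angle_eq_arccos gen_thy_angle_def spade_conv_def)

text \<open>
  The double angle has cosine \<open>2 (3 / 4)\<^sup>2 - 1 = 1 / 8\<close>.
\<close>

lemma two_arccos_three_quarters: "2 * arccos (3 / 4) \<noteq> pi / 2"
proof
  assume "2 * arccos (3 / 4) = pi / 2"
  then have "cos (2 * arccos (3 / 4)) = 0" by (metis cos_pi_half)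
  then show False by (simp add: cos_double_cos power2_eq_square)
qed

text \<open>
  The standard unit vectors \<open>e\<close> and \<open>f\<close> are at right angles. The diagonal vectors \<open>e + f\<close> and
  \<open>e - f\<close>, however, form with the axes angles whose cosine is \<open>3 / 4\<close>: the normalized vectors have
  a sum of norm 2 and a difference of norm 1. Each of the three conditions, taken at
  \<open>e\<close> and \<open>f\<close>, would make two such angles add up to a right angle.
\<close>

lemma sum_norm_not_An8_An9_An10:
  shows "\<not> An8 sum_norm (gen_thy_angle sum_norm)"
    and "\<not> An9 sum_norm (gen_thy_angle sum_norm)"
    and "\<not> An10 sum_norm (gen_thy_angle sum_norm)"
proof -
  define e f :: "real \<times> real" where "e = (1, 0)" and "f = (0, 1)"
  note eval = gen_thy_angle_sum_norm thy_cos_def sum_norm_def zero_prod_def power2_eq_square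
    e_def f_def
  let ?ang = "gen_thy_angle sum_norm"
  have dom: "e \<notin> zero_set sum_norm" "f \<notin> zero_set sum_norm" "e + f \<notin> zero_set sum_norm"
    "e - f \<notin> zero_set sum_norm"
    by (simp_all add: zero_set_def sum_norm_def e_def f_def)
  have right: "?ang e f = pi / 2" "?ang (- e) f = pi / 2" by (simp_all add: eval)
  have "?ang e (e + f) = arccos (3 / 4)" "?ang (e + f) f = arccos (3 / 4)"
    by (simp_all add: eval)
  then show "\<not> An8 sum_norm ?ang"
    using dom right two_arccos_three_quarters unfolding An8_def
    by (metis mult_2)
  have "?ang (- e) (f - e) = arccos (3 / 4)" "?ang (- f) (e - f) = arccos (3 / 4)"
    by (simp_all add: eval)
  then have "?ang e f + ?ang (- e) (f - e) + ?ang (- f) (e - f) \<noteq> pi"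
    using right two_arccos_three_quarters by linarith
  then show "\<not> An9 sum_norm ?ang" using dom unfolding An9_def by blast
  have "?ang f (f - e) = arccos (3 / 4)" "?ang e (e - f) = arccos (3 / 4)"
    by (simp_all add: eval)
  then show "\<not> An10 sum_norm ?ang"
    using dom right two_arccos_three_quarters unfolding An10_def
    by (metis mult_2)
qed

section \<open>The angle axioms\<close>

lemma gen_thy_angle_An1:
  fixes w :: "'a::{real_vector, topological_ab_group_add} \<Rightarrow> real"
  assumes w: "normable_hw_space w"
  shows "An1 w (gen_thy_angle w)"
proof -
  define p where "p = conv_gauge w"
  have p: "is_norm p" and tvs: "real_tvs TYPE('a)"
    using w by (simp_all add: p_def normable_hw_space_def hw_space_def)
  have pcont: "continuous_on UNIV p" using continuous_on_conv_gauge[OF w] by (simp add: p_def)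
  have range: "- 1 \<le> thy_cos p x y" "thy_cos p x y \<le> 1" if "x \<noteq> 0" "y \<noteq> 0" for x y
    using thy_cos_abs_le_1[OF p that] by auto
  have angle: "gen_thy_angle w x y = arccos (thy_cos p x y)" if "x \<noteq> 0" "y \<noteq> 0" for x y
    using gen_thy_angle_eq_thy_angle[OF w that] by (simp add: p_def thy_angle_eq_arccos)
  have "continuous_on ((- {0}) \<times> (- {0})) (\<lambda>z. thy_cos p (fst z) (snd z))"
    by (intro continuous_on_thy_cos tvs p pcont continuous_intros) auto
  then have "continuous_on ((- {0}) \<times> (- {0})) (\<lambda>z. arccos (thy_cos p (fst z) (snd z)))"
    using range by (intro continuous_on_arccos) auto
  then have "continuous_on ((- {0}) \<times> (- {0})) (\<lambda>(x, y). gen_thy_angle w x y)"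
  proof (rule continuous_on_eq)
    fix z :: "'a \<times> 'a" assume "z \<in> (- {0}) \<times> (- {0})"
    then show "arccos (thy_cos p (fst z) (snd z)) = (case z of (x, y) \<Rightarrow> gen_thy_angle w x y)"
      using angle[of "fst z" "snd z"] by (cases z) simp
  qed
  moreover have "gen_thy_angle w x y \<in> {0..pi}" if "x \<noteq> 0" "y \<noteq> 0" for x y
    using range[OF that] by (simp add: angle that arccos_lbound arccos_ubound)
  ultimately show ?thesis by (simp add: An1_def normable_zero_set[OF w])
qed

lemma gen_thy_angle_An2_to_An7:
  assumes w: "normable_hw_space w"
  shows "An2 w (gen_thy_angle w)" "An3 w (gen_thy_angle w)" "An4 w (gen_thy_angle w)"
    "An5 w (gen_thy_angle w)" "An6 w (gen_thy_angle w)" "An7 w (gen_thy_angle w)"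
proof -
  define p where "p = conv_gauge w"
  have p: "is_norm p" using w by (simp add: p_def normable_hw_space_def)
  note Z = normable_zero_set[OF w]
  have angle: "gen_thy_angle w x y = arccos (thy_cos p x y)" if "x \<noteq> 0" "y \<noteq> 0" for x y
    using gen_thy_angle_eq_thy_angle[OF w that] by (simp add: p_def thy_angle_eq_arccos)
  note sign = thy_cos_minus_left[OF p] thy_cos_minus_right[OF p]
  show "An2 w (gen_thy_angle w)" by (simp add: An2_def Z angle thy_cos_self[OF p])
  show "An3 w (gen_thy_angle w)" by (simp add: An3_def Z angle sign thy_cos_self[OF p])
  show "An4 w (gen_thy_angle w)"
    using thy_cos_commute[OF p] by (auto simp: An4_def Z angle intro: arg_cong[of _ _ arccos])
  show "An5 w (gen_thy_angle w)" by (simp add: An5_def Z angle thy_cos_scaleR[OF p])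
  show "An6 w (gen_thy_angle w)" by (simp add: An6_def Z angle sign)
  show "An7 w (gen_thy_angle w)"
    using thy_cos_abs_le_1[OF p] by (simp add: An7_def Z angle sign arccos_minus abs_le_iff)
qed

lemma gen_thy_angle_An11:
  fixes w :: "'a::{real_vector, topological_ab_group_add} \<Rightarrow> real"
  assumes w: "normable_hw_space w"
  shows "An11 w (gen_thy_angle w)"
  unfolding An11_def
proof (intro allI impI)
  fix x y assume xy: "x \<notin> zero_set w \<and> y \<notin> zero_set w \<and> x \<noteq> y \<and> independent {x, y}"
  define p where "p = conv_gauge w"
  have p: "is_norm p" and tvs: "real_tvs TYPE('a)"
    using w by (simp_all add: p_def normable_hw_space_def hw_space_def)
  have pcont: "continuous_on UNIV p" using continuous_on_conv_gauge[OF w] by (simp add: p_def)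
  have x: "x \<noteq> 0" using xy by (simp add: normable_zero_set[OF w])
  have nz: "y + t *\<^sub>R x \<noteq> 0" for t
  proof
    assume "y + t *\<^sub>R x = 0"
    then have "y = (- t) *\<^sub>R x" by (simp add: eq_neg_iff_add_eq_0)
    then have "y \<in> span {x}" by (metis span_base span_scale singletonI)
    moreover have "y \<notin> span {x}"
      using xy by (metis independent_insert insert_commute singletonD)
    ultimately show False by simp
  qed
  have "continuous_on UNIV (\<lambda>t. y + t *\<^sub>R x)"
    by (intro continuous_on_add continuous_on_const real_tvs_continuous_on_scaleR[OF tvs]
        continuous_on_id)
  then have "continuous_on UNIV (\<lambda>t. thy_cos p x (y + t *\<^sub>R x))"
    using x nz by (intro continuous_on_thy_cos tvs p pcont continuous_on_const) auto
  note line = thy_angle_line_homeomorphism[OF p x nz this]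
  have "(\<lambda>t. gen_thy_angle w x (y + t *\<^sub>R x)) = (\<lambda>t. thy_angle p x (y + t *\<^sub>R x))"
    using gen_thy_angle_eq_thy_angle[OF w x nz] by (simp add: p_def)
  then show "strict_antimono_on UNIV (\<lambda>t. gen_thy_angle w x (y + t *\<^sub>R x)) \<and>
      (\<exists>g. homeomorphism UNIV {0<..<pi} (\<lambda>t. gen_thy_angle w x (y + t *\<^sub>R x)) g)"
    using line by simp
qed

theorem proposition6:
  fixes w :: "'a::{real_vector, topological_ab_group_add} \<Rightarrow> real"
  assumes "normable_hw_space w"
  shows
    "((\<forall>x y. \<bar>spade_conv w x y\<bar> \<le> w x * w y) \<and>
      (\<forall>x y. x \<noteq> 0 \<and> y \<noteq> 0 \<longrightarrow> gen_thy_angle_defined w x y)) \<and>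
     (An1 w (gen_thy_angle w) \<and> An2 w (gen_thy_angle w) \<and> An3 w (gen_thy_angle w) \<and>
      An4 w (gen_thy_angle w) \<and> An5 w (gen_thy_angle w) \<and> An6 w (gen_thy_angle w) \<and>
      An7 w (gen_thy_angle w) \<and> angle_space w (gen_thy_angle w)) \<and>
     (is_norm w \<longrightarrow>
      (\<forall>x y. x \<noteq> 0 \<and> y \<noteq> 0 \<longrightarrow> gen_thy_angle w x y = thy_angle w x y)) \<and>
     (\<forall>ip. is_inner_product ip \<and> (\<forall>x. w x = sqrt (ip x x)) \<longrightarrow>
      (\<forall>x y. x \<noteq> 0 \<and> y \<noteq> 0 \<longrightarrow> gen_thy_angle w x y = euclid_angle ip x y)) \<and>
     ((\<exists>v :: real \<times> real \<Rightarrow> real. normable_hw_space v \<and> \<not> An8 v (gen_thy_angle v)) \<and>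
      (\<exists>v :: real \<times> real \<Rightarrow> real. normable_hw_space v \<and> \<not> An9 v (gen_thy_angle v)) \<and>
      (\<exists>v :: real \<times> real \<Rightarrow> real. normable_hw_space v \<and> \<not> An10 v (gen_thy_angle v))) \<and>
     An11 w (gen_thy_angle w)"
proof (intro conjI)
  have normed: "gen_thy_angle w x y = thy_angle w x y" if "is_norm w" "x \<noteq> 0" "y \<noteq> 0" for x y
    using gen_thy_angle_eq_thy_angle[OF assms that(2,3)] conv_gauge_norm_eq[OF that(1)] by simp
  show "\<forall>x y. \<bar>spade_conv w x y\<bar> \<le> w x * w y"
    using spade_conv_CSB[OF assms] by blast
  then show "\<forall>x y. x \<noteq> 0 \<and> y \<noteq> 0 \<longrightarrow> gen_thy_angle_defined w x y"
    using normable_weight_pos[OF assms]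
    by (auto simp: gen_thy_angle_defined_def less_imp_neq[symmetric])
  show "angle_space w (gen_thy_angle w)"
    using assms gen_thy_angle_An1[OF assms] gen_thy_angle_An2_to_An7[OF assms]
    unfolding angle_space_def normable_hw_space_def by blast
  show "is_norm w \<longrightarrow> (\<forall>x y. x \<noteq> 0 \<and> y \<noteq> 0 \<longrightarrow> gen_thy_angle w x y = thy_angle w x y)"
    using normed by blast
  show "\<forall>ip. is_inner_product ip \<and> (\<forall>x. w x = sqrt (ip x x)) \<longrightarrow>
      (\<forall>x y. x \<noteq> 0 \<and> y \<noteq> 0 \<longrightarrow> gen_thy_angle w x y = euclid_angle ip x y)"
    using normed is_inner_product_imp_norm thy_angle_eq_euclid_angle by metis
qed (use gen_thy_angle_An1[OF assms] gen_thy_angle_An2_to_An7[OF assms]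
    gen_thy_angle_An11[OF assms] sum_norm_not_An8_An9_An10 normable_sum_norm in blast)+

end
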